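(* Let $X$ be a finite set of cardinality $n$ and let $N=\binom{n}{2}$. There are exactly $$\sum_{c=1}^n\sum_{k=0}^N\binom{N}{k}S(n+k,c)\sum_{m=1}^{N-k}S(N-k,m)\,2^{N-k-m}$$ different principal right ideals in $\mathcal{M}(X)$.
   Context: $\mathcal{M}(X)=X^{X\times X}$ is the set of all binary operations on $X$, a monoid under $\triangleright$ defined by $a(\circ\triangleright\ast)b=(a\circ b)\ast(b\circ a)$ for all $\circ,\ast\in\mathcal{M}(X)$ and $a,b\in X$, with identity the left zeros operation $a\circ_{lz}b=a$. The principal right ideal generated by $\ast\in\mathcal{M}(X)$ is $\{\ast\triangleright\circ:\circ\in\mathcal{M}(X)\}$. $S(p,q)$ denotes the Stirling number of the second kind (the number of partitions of a $p$-element set into $q$ nonempty blocks).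
   Formalization: The inner sum starts at m=0 instead of m=1 (with S(0,0)=1), since as printed the k=N term vanishes and the formula is false for every n≥1 (for n=1 it gives 0, but there is 1 ideal); X is assumed nonempty, since for n=0 the formula gives 0 but there is 1 ideal. *)

theory Defs
  imports "HOL-Algebra.Group" "HOL-Combinatorics.Stirling"
begin

(* Operations are uncurried and extensional on X \<times> X, so that each element of
   X^(X \<times> X) is represented by exactly one HOL function. *)
definition binop_monoid :: "'a set \<Rightarrow> ('a \<times> 'a \<Rightarrow> 'a) monoid" where
  "binop_monoid X =
    \<lparr>carrier = X \<times> X \<rightarrow>\<^sub>E X,
     monoid.mult = (\<lambda>f g. \<lambda>(a, b)\<in>X \<times> X. g (f (a, b), f (b, a))),
     one = (\<lambda>(a, b)\<in>X \<times> X. a)\<rparr>"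

definition principal_right_ideal :: "('a, 'b) monoid_scheme \<Rightarrow> 'a \<Rightarrow> 'a set" where
  "principal_right_ideal M f = {f \<otimes>\<^bsub>M\<^esub> g | g. g \<in> carrier M}"

lemma monoid_binop_monoid: "monoid (binop_monoid X)"
proof (rule monoidI)
  fix f g h
  assume "f \<in> carrier (binop_monoid X)" "g \<in> carrier (binop_monoid X)"
    "h \<in> carrier (binop_monoid X)"
  then show "f \<otimes>\<^bsub>binop_monoid X\<^esub> g \<otimes>\<^bsub>binop_monoid X\<^esub> h =
    f \<otimes>\<^bsub>binop_monoid X\<^esub> (g \<otimes>\<^bsub>binop_monoid X\<^esub> h)"
    by (fastforce simp: binop_monoid_def restrict_def PiE_iff)
next
  fix f assume f: "f \<in> carrier (binop_monoid X)"
  show "\<one>\<^bsub>binop_monoid X\<^esub> \<otimes>\<^bsub>binop_monoid X\<^esub> f = f"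
    using f by (auto simp: binop_monoid_def restrict_def PiE_iff extensional_def fun_eq_iff)
  show "f \<otimes>\<^bsub>binop_monoid X\<^esub> \<one>\<^bsub>binop_monoid X\<^esub> = f"
    using f by (auto simp: binop_monoid_def restrict_def PiE_iff extensional_def fun_eq_iff)
qed (auto simp: binop_monoid_def PiE_iff split: if_splits)

(* Starting the sum at 0 only matters for p = 0, where it supplies the empty partition. *)
lemma sum_Stirling_power2_from_0:
  "(\<Sum>m = 0..p. Stirling p m * 2 ^ (p - m)) =
    (if p = 0 then 1 else \<Sum>m = 1..p. Stirling p m * 2 ^ (p - m))"
  by (cases p) (simp_all add: sum.atLeast_Suc_atMost)

end

theory Submission
  imports Defs "HOL-Library.Disjoint_Sets"
begin

text \<open>Put \<open>F (a, b) = (f (a, b), f (b, a))\<close>. Then \<open>f \<otimes> g\<close> is \<open>g \<circ> F\<close>, so the right ideal of \<open>f\<close>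
  consists of all functions that are constant on the fibres of \<open>F\<close>, and it determines and is
  determined by the partition of \<open>X \<times> X\<close> into these fibres. As \<open>F\<close> commutes with the coordinate
  swap, this partition is swap-invariant; as the swap fixes only the \<open>n\<close> diagonal points, at most
  \<open>n\<close> blocks are mapped to themselves. Conversely every invariant partition with at most \<open>n\<close> fixed
  blocks arises: fixed blocks go to the diagonal, and a swapped pair of blocks goes to an
  off-diagonal orbit contained in it.

  Invariant partitions are counted by inserting one orbit at a time. If there are \<open>c\<close> fixed and
  \<open>q\<close> moved blocks, a fixed point forms a new block or joins one of the \<open>c\<close> fixed ones; a free orbit
  \<open>{x, s x}\<close> can do the same or, alternatively, form two new moved blocks, or put \<open>x\<close> into one of the
  \<open>q\<close> moved blocks and \<open>s x\<close> into the image block. The first two options give the Stirling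
  recurrence; the last two, with \<open>q = 2 m\<close>, give that of \<open>Stirling r m * 2 ^ (r - m)\<close>. Choosing
  between the two kinds for every free orbit gives the binomial coefficient.\<close>

section \<open>Invariant partitions and their fixed and moved blocks\<close>

definition inv_partitions :: "('b \<Rightarrow> 'b) \<Rightarrow> 'b set \<Rightarrow> 'b set set set" where
  "inv_partitions s A = {P. partition_on A P \<and> (\<forall>C\<in>P. s ` C \<in> P)}"

definition fixed_blocks :: "('b \<Rightarrow> 'b) \<Rightarrow> 'b set set \<Rightarrow> 'b set set" where
  "fixed_blocks s P = {C \<in> P. s ` C = C}"

definition moved_blocks :: "('b \<Rightarrow> 'b) \<Rightarrow> 'b set set \<Rightarrow> 'b set set" where
  "moved_blocks s P = {C \<in> P. s ` C \<noteq> C}"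

lemma finite_inv_partitions:
  assumes "finite A" shows "finite (inv_partitions s A)"
  by (rule finite_subset[of _ "Pow (Pow A)"])
    (use assms in \<open>auto simp: inv_partitions_def partition_on_def\<close>)

lemma card_fixed_plus_moved:
  assumes "finite P"
  shows "card (fixed_blocks s P) + card (moved_blocks s P) = card P"
proof -
  have "card (fixed_blocks s P \<union> moved_blocks s P)
      = card (fixed_blocks s P) + card (moved_blocks s P)"
    by (rule card_Un_disjoint) (use assms in \<open>auto simp: fixed_blocks_def moved_blocks_def\<close>)
  moreover have "fixed_blocks s P \<union> moved_blocks s P = P"
    by (auto simp: fixed_blocks_def moved_blocks_def)
  ultimately show ?thesis by simp
qed

lemma partition_on_block_unique:
  assumes "partition_on A P" "B \<in> P" "C \<in> P" "y \<in> B" "y \<in> C"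
  shows "B = C"
  using assms by (auto simp: partition_on_def disjoint_def)

subsection \<open>Inserting an orbit into an invariant partition\<close>

text \<open>A block inside the inserted orbit leaves an empty trace, which a partition cannot
  contain.\<close>

definition trace_partition :: "'b set \<Rightarrow> 'b set set \<Rightarrow> 'b set set" where
  "trace_partition A Q = (\<lambda>B. B \<inter> A) ` Q - {{}}"

text \<open>The case \<open>s x = x\<close> is allowed, so that fixed points and free orbits are
  inserted by the same construction.\<close>

locale orbit_insertion =
  fixes s :: "'b \<Rightarrow> 'b" and A :: "'b set" and x :: 'b
  assumes invol: "\<And>y. s (s y) = y"
    and closed: "\<And>y. y \<in> A \<Longrightarrow> s y \<in> A"
    and x_notin: "x \<notin> A"
    and finite_A: "finite A"
begin

abbreviation A' where "A' \<equiv> A \<union> {x, s x}"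

lemma sx_notin: "s x \<notin> A"
  using closed[of "s x"] invol x_notin by auto

lemma image_invol [simp]: "s ` s ` C = C"
  by (auto simp: image_image invol)

lemma image_eq_iff: "s ` C = s ` D \<longleftrightarrow> C = D"
  by (metis image_invol)

lemma image_Int_A: "s ` (B \<inter> A) = s ` B \<inter> A"
proof -
  have "inj s" by (metis invol injI)
  moreover have "s ` A = A"
    using closed invol by (metis image_iff subsetI subset_antisym image_subsetI)
  ultimately show ?thesis by (simp add: image_Int)
qed

text \<open>If \<open>C\<close> is its own image, both conditions hold for \<open>D = C\<close> and
  this block receives the whole orbit; this includes \<open>C = {}\<close>. Otherwise
  \<open>x\<close> goes to \<open>C\<close> and \<open>s x\<close> to the image of
  \<open>C\<close>.\<close>

definition enlarge :: "'b set \<Rightarrow> 'b set \<Rightarrow> 'b set" where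
  "enlarge C D = D \<union> (if D = C then {x} else {}) \<union> (if D = s ` C then {s x} else {})"

text \<open>The orbit of \<open>x\<close> joins the orbit of the block \<open>C\<close>; the value \<open>C = {}\<close> encodes that
  \<open>{x, s x}\<close> becomes a block of its own.\<close>

definition join_block :: "'b set set \<Rightarrow> 'b set \<Rightarrow> 'b set set" where
  "join_block P C = enlarge C ` insert C P"

definition add_singletons :: "'b set set \<Rightarrow> 'b set set" where
  "add_singletons P = insert {x} (insert {s x} P)"

text \<open>A fixed point can only join a fixed block: joining a moved one would put it into that
  block and into its image.\<close>

definition joinable :: "'b set set \<Rightarrow> 'b set set" where
  "joinable P = insert {} (if s x = x then fixed_blocks s P else P)"

lemma enlarge_Int: "D \<subseteq> A \<Longrightarrow> enlarge C D \<inter> A = D"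
  using x_notin sx_notin by (auto simp: enlarge_def)

lemma enlarge_subset: "enlarge C D \<subseteq> D \<union> {x, s x}"
  by (auto simp: enlarge_def)

lemma enlarge_image: "enlarge C (s ` D) = s ` enlarge C D"
proof -
  have "s ` D = C \<longleftrightarrow> D = s ` C" by (metis image_invol)
  then show ?thesis
    by (auto simp: enlarge_def invol image_eq_iff)
qed

lemma block_subset: "P \<in> inv_partitions s A \<Longrightarrow> C \<in> joinable P \<Longrightarrow> D \<in> insert C P \<Longrightarrow> D \<subseteq> A"
  by (auto simp: inv_partitions_def partition_on_def joinable_def fixed_blocks_def split: if_splits)

lemma inj_enlarge:
  assumes "P \<in> inv_partitions s A" "C \<in> joinable P"
  shows "inj_on (enlarge C) (insert C P)"
  by (rule inj_on_inverseI[where g = "\<lambda>B. B \<inter> A"]) (rule enlarge_Int[OF block_subset[OF assms]])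

text \<open>The delicate case is \<open>s x = x\<close>, where the clause for \<open>s x\<close> in
  \<open>enlarge\<close> also inserts \<open>x\<close>. Joinability makes \<open>C\<close> its own
  image then, so both clauses name the same block.\<close>

lemma x_in_enlarge_iff:
  assumes "P \<in> inv_partitions s A" "C \<in> joinable P" "D \<in> insert C P"
  shows "x \<in> enlarge C D \<longleftrightarrow> D = C"
proof -
  have "D \<subseteq> A" using assms block_subset by blast
  moreover have "s x = x \<Longrightarrow> s ` C = C"
    using assms(2) by (auto simp: joinable_def fixed_blocks_def)
  ultimately show ?thesis
    using x_notin unfolding enlarge_def by (cases "s x = x") (simp_all, blast+)
qed

lemma sx_in_enlarge_iff:
  assumes "P \<in> inv_partitions s A" "C \<in> joinable P" "D \<in> insert C P"
  shows "s x \<in> enlarge C D \<longleftrightarrow> D = s ` C"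
proof -
  have "D \<subseteq> A" using assms block_subset by blast
  moreover have "s x = x \<Longrightarrow> s ` C = C"
    using assms(2) by (auto simp: joinable_def fixed_blocks_def)
  ultimately show ?thesis
    using sx_notin unfolding enlarge_def by (cases "s x = x") (simp_all, blast+)
qed

lemma image_in_insert:
  assumes "P \<in> inv_partitions s A" "C \<in> joinable P" "D \<in> insert C P"
  shows "s ` D \<in> insert C P"
  using assms by (auto simp: inv_partitions_def joinable_def fixed_blocks_def split: if_splits)

lemma join_block_in:
  assumes P: "P \<in> inv_partitions s A" and C: "C \<in> joinable P"
  shows "join_block P C \<in> inv_partitions s A'"
proof -
  have part: "partition_on A P" using P by (simp add: inv_partitions_def)
  have Cin: "C \<in> insert {} P" using C by (auto simp: joinable_def fixed_blocks_def split: if_splits)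
  have sCin: "s ` C \<in> insert C P" using image_in_insert[OF P C] by simp
  have "\<Union> (join_block P C) = A'"
  proof
    show "\<Union> (join_block P C) \<subseteq> A'"
    proof (rule Union_least)
      fix B assume "B \<in> join_block P C"
      then obtain D where "D \<in> insert C P" "B = enlarge C D"
        unfolding join_block_def by blast
      then show "B \<subseteq> A'"
        using block_subset[OF P C, of D] enlarge_subset[of C D] by blast
    qed
    have "A \<subseteq> \<Union> (join_block P C)"
      using part by (auto simp: join_block_def enlarge_def partition_on_def)
    moreover have "x \<in> enlarge C C" "s x \<in> enlarge C (s ` C)"
      by (auto simp: enlarge_def)
    ultimately show "A' \<subseteq> \<Union> (join_block P C)"
      using sCin unfolding join_block_def by blast
  qed
  moreover have "{} \<notin> join_block P C"
    using part unfolding join_block_def enlarge_def partition_on_def by fastforce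
  \<comment> \<open>The traces on \<open>A\<close> are disjoint, and \<open>x\<close> and
    \<open>s x\<close> each lie in only one enlarged block, so no point is shared.\<close>
  moreover have "disjoint (join_block P C)"
  proof (rule disjointI)
    fix B B' assume "B \<in> join_block P C" "B' \<in> join_block P C" and ne: "B \<noteq> B'"
    then obtain D D' where D: "D \<in> insert C P" "B = enlarge C D"
      and D': "D' \<in> insert C P" "B' = enlarge C D'"
      unfolding join_block_def by blast
    have "D \<noteq> D'" using ne D D' by blast
    then have DD': "D \<inter> D' = {}"
      using D(1) D'(1) Cin part by (auto simp: partition_on_def disjoint_def)
    have BD: "B \<inter> A = D" "B' \<inter> A = D'"
      unfolding D(2) D'(2) using enlarge_Int block_subset[OF P C] D(1) D'(1) by blast+
    have BA': "B \<subseteq> A'"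
      unfolding D(2) using block_subset[OF P C D(1)] enlarge_subset[of C D] by blast
    have orbit: "\<not> (x \<in> B \<and> x \<in> B')" "\<not> (s x \<in> B \<and> s x \<in> B')"
      unfolding D(2) D'(2)
      using \<open>D \<noteq> D'\<close> x_in_enlarge_iff[OF P C D(1)] x_in_enlarge_iff[OF P C D'(1)]
        sx_in_enlarge_iff[OF P C D(1)] sx_in_enlarge_iff[OF P C D'(1)] by auto
    show "B \<inter> B' = {}"
    proof (rule equals0I)
      fix y assume y: "y \<in> B \<inter> B'"
      then consider "y \<in> A" | "y = x" | "y = s x" using BA' by blast
      then show False
        by cases (use y orbit DD' BD in blast)+
    qed
  qed
  moreover have "s ` B \<in> join_block P C" if B: "B \<in> join_block P C" for B
  proof -
    obtain D where D: "D \<in> insert C P" "B = enlarge C D"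
      using B unfolding join_block_def by blast
    have "enlarge C (s ` D) \<in> join_block P C"
      unfolding join_block_def by (rule imageI[OF image_in_insert[OF P C D(1)]])
    then show ?thesis by (simp only: enlarge_image D(2))
  qed
  ultimately show ?thesis
    by (simp add: inv_partitions_def partition_on_def)
qed

lemma trace_join_block:
  assumes P: "P \<in> inv_partitions s A" and C: "C \<in> joinable P"
  shows "trace_partition A (join_block P C) = P"
proof -
  have "(\<lambda>B. B \<inter> A) ` join_block P C = (\<lambda>D. D) ` insert C P"
    unfolding join_block_def image_image
    by (rule image_cong) (use enlarge_Int block_subset[OF P C] in auto)
  moreover have "{} \<notin> P" "C \<in> insert {} P"
    using P C by (auto simp: inv_partitions_def partition_on_def joinable_def fixed_blocks_def split: if_splits)
  ultimately show ?thesis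
    unfolding trace_partition_def by auto
qed

text \<open>\<open>C\<close> is recovered as the trace on \<open>A\<close> of the block containing
  \<open>x\<close>.\<close>

lemma inj_join_block:
  assumes P: "P \<in> inv_partitions s A"
  shows "inj_on (join_block P) (joinable P)"
proof (rule inj_onI)
  fix C C' assume C: "C \<in> joinable P" and C': "C' \<in> joinable P"
    and eq: "join_block P C = join_block P C'"
  have "enlarge C C \<in> join_block P C'"
    unfolding eq[symmetric] by (simp add: join_block_def)
  then obtain D where D: "D \<in> insert C' P" "enlarge C C = enlarge C' D"
    by (auto simp: join_block_def)
  have "x \<in> enlarge C' D" unfolding D(2)[symmetric] by (simp add: enlarge_def)
  then have "D = C'" using x_in_enlarge_iff[OF P C' D(1)] by simp
  then show "C = C'"
    using D enlarge_Int block_subset[OF P C, of C] block_subset[OF P C', of C']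
    by (metis insertI1)
qed

lemma add_singletons_in:
  assumes P: "P \<in> inv_partitions s A" and "s x \<noteq> x"
  shows "add_singletons P \<in> inv_partitions s A'"
proof -
  have part: "partition_on A P" using P by (simp add: inv_partitions_def)
  have "partition_on (A' - {x} - {s x}) P"
    using part x_notin sx_notin by (simp add: Diff_insert0 insert_Diff_if assms(2))
  moreover have "disjnt {s x} (\<Union>P)" "disjnt {x} (\<Union> (insert {s x} P))"
    using part x_notin sx_notin assms(2) by (auto simp: partition_on_def disjnt_def)
  ultimately have "partition_on A' (add_singletons P)"
    unfolding add_singletons_def using assms(2) by (simp add: partition_on_insert)
  then show ?thesis
    using P by (auto simp: inv_partitions_def add_singletons_def invol)
qed

lemma trace_add_singletons:
  assumes P: "P \<in> inv_partitions s A"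
  shows "trace_partition A (add_singletons P) = P"
proof -
  have "(\<lambda>B. B \<inter> A) ` P = (\<lambda>B. B) ` P"
    by (rule image_cong) (use P in \<open>auto simp: inv_partitions_def partition_on_def\<close>)
  then show ?thesis
    using P x_notin sx_notin
    by (auto simp: trace_partition_def add_singletons_def inv_partitions_def partition_on_def)
qed

text \<open>In \<open>join_block P C\<close> the block of \<open>x\<close> is never
  \<open>{x}\<close>: it contains points of \<open>A\<close> if \<open>C\<close> is nonempty, and
  \<open>s x\<close> if \<open>C\<close> is empty.\<close>

lemma add_singletons_ne_join_block:
  assumes P: "P \<in> inv_partitions s A" and C: "C \<in> joinable P" and "s x \<noteq> x"
  shows "add_singletons P \<noteq> join_block P C"
proof
  assume "add_singletons P = join_block P C"
  then have "{x} \<in> join_block P C" by (auto simp: add_singletons_def)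
  then obtain D where D: "D \<in> insert C P" "{x} = enlarge C D"
    by (auto simp: join_block_def)
  then have "D = C" using x_in_enlarge_iff[OF P C D(1)] by auto
  moreover have "D = {}" using D enlarge_Int[of D C] block_subset[OF P C D(1)] x_notin by auto
  ultimately show False using D assms(3) by (auto simp: enlarge_def)
qed

section \<open>Every invariant partition arises by insertion\<close>

lemma trace_in:
  assumes Q: "Q \<in> inv_partitions s A'"
  shows "trace_partition A Q \<in> inv_partitions s A"
proof -
  have part: "partition_on A' Q" and inv: "\<And>B. B \<in> Q \<Longrightarrow> s ` B \<in> Q"
    using Q by (auto simp: inv_partitions_def)
  have "s ` C \<in> trace_partition A Q" if "C \<in> trace_partition A Q" for C
    using that inv by (auto simp: trace_partition_def image_Int_A)
  moreover have "\<Union> (trace_partition A Q) = A"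
  proof -
    have "\<Union> (trace_partition A Q) = \<Union> Q \<inter> A" unfolding trace_partition_def by blast
    then show ?thesis using part by (auto simp: partition_on_def)
  qed
  moreover have "disjoint (trace_partition A Q)"
    using part by (auto simp: trace_partition_def partition_on_def disjoint_def) 
  ultimately show ?thesis
    by (auto simp: inv_partitions_def partition_on_def trace_partition_def)
qed

text \<open>The block \<open>B\<close> of \<open>x\<close> decides. If it meets \<open>A\<close> or
  contains \<open>s x\<close>, its trace is the block that was joined. Otherwise it is
  \<open>{x}\<close>, and invariance makes \<open>{s x}\<close> a block too.\<close>

lemma inv_partition_cases:
  assumes Q: "Q \<in> inv_partitions s A'"
  defines "P \<equiv> trace_partition A Q"
  shows "(\<exists>C\<in>joinable P. Q = join_block P C) \<or> (s x \<noteq> x \<and> Q = add_singletons P)"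
proof -
  have part: "partition_on A' Q" and inv: "\<And>B. B \<in> Q \<Longrightarrow> s ` B \<in> Q"
    using Q by (auto simp: inv_partitions_def)
  obtain B where B: "B \<in> Q" "x \<in> B" using part by (auto simp: partition_on_def)
  have sB: "s ` B \<in> Q" "s x \<in> s ` B" using inv B by auto
  have xB: "E = B" if "E \<in> Q" "x \<in> E" for E
    using partition_on_block_unique[OF part] that B by blast
  have sxB: "E = s ` B" if "E \<in> Q" "s x \<in> E" for E
    using partition_on_block_unique[OF part] that sB by blast
  have sub: "E \<subseteq> A'" if "E \<in> Q" for E using that part by (auto simp: partition_on_def)
  have ne: "E \<noteq> {}" if "E \<in> Q" for E using that part by (auto simp: partition_on_def)
  define C where "C = B \<inter> A"
  show ?thesis
  proof (cases "C \<noteq> {} \<or> s x \<in> B")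
    case True
    \<comment> \<open>The trace \<open>C\<close> identifies its block even when it is empty: then
      \<open>B\<close> contains the whole orbit, which leaves no room for another block without
      points of \<open>A\<close>.\<close>
    have blockeq: "E = B" if "E \<in> Q" "E \<inter> A = C" for E
    proof (cases "C = {}")
      case True
      then have "E \<subseteq> {x, s x}" using sub[OF that(1)] that(2) by auto
      then have "x \<in> E \<or> s x \<in> E" using ne[OF that(1)] by auto
      moreover have "s ` B = B" using sxB[OF B(1)] \<open>C \<noteq> {} \<or> s x \<in> B\<close> True by auto
      ultimately show ?thesis using xB sxB that by auto
    next
      case False
      then show ?thesis using partition_on_block_unique[OF part that(1) B(1)] that
        by (auto simp: C_def)
    qed
    have sblockeq: "E = s ` B" if "E \<in> Q" "E \<inter> A = s ` C" for E
    proof -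
      have "s ` E \<in> Q" "s ` E \<inter> A = C"
        using that inv image_Int_A[of E, symmetric] by (simp_all only: image_invol)
      then show ?thesis using blockeq by (metis image_invol)
    qed
    have sC: "s ` B \<inter> A = s ` C" by (simp add: C_def image_Int_A)
    \<comment> \<open>Membership of \<open>x\<close> and \<open>s x\<close> in a block can be read
      off its trace, so \<open>enlarge\<close> undoes the restriction to \<open>A\<close>.\<close>
    have E_eq: "enlarge C (E \<inter> A) = E" if E: "E \<in> Q" for E
    proof -
      have "x \<in> E \<longleftrightarrow> E \<inter> A = C"
        using xB[OF E] blockeq[OF E] B by (auto simp: C_def)
      moreover have "s x \<in> E \<longleftrightarrow> E \<inter> A = s ` C"
        using sxB[OF E] sblockeq[OF E] sB(2) sC by metis
      ultimately have "enlarge C (E \<inter> A)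
          = E \<inter> A \<union> (if x \<in> E then {x} else {}) \<union> (if s x \<in> E then {s x} else {})"
        unfolding enlarge_def by simp
      then show ?thesis using sub[OF E] by auto
    qed
    \<comment> \<open>The trace partition has lost the empty trace. A block has empty trace only if
      \<open>C = {}\<close>, and inserting \<open>C\<close> restores it.\<close>
    have "insert C P = (\<lambda>E. E \<inter> A) ` Q"
    proof -
      have "E \<inter> A \<noteq> {}" if "E \<in> Q" "C \<noteq> {}" for E
      proof
        assume "E \<inter> A = {}"
        then have "E \<subseteq> {x, s x}" using sub[OF that(1)] by auto
        then have "x \<in> E \<or> s x \<in> E" using ne[OF that(1)] by auto
        then have "E \<inter> A = C \<or> E \<inter> A = s ` C" using xB sxB sC that by (auto simp: C_def)
        then show False using \<open>E \<inter> A = {}\<close> that by auto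
      qed
      then show ?thesis
        using B unfolding P_def trace_partition_def C_def by (cases "C = {}") (auto simp: C_def)
    qed
    then have "join_block P C = Q"
      unfolding join_block_def using E_eq by (simp add: image_image)
    moreover have "C \<in> joinable P"
    proof -
      have "C \<in> insert {} P" using B by (auto simp: P_def trace_partition_def C_def)
      moreover have "s ` C = C" if "s x = x"
        using sC xB[OF sB(1)] sB(2) that by (simp add: C_def)
      ultimately show ?thesis by (auto simp: joinable_def fixed_blocks_def)
    qed
    ultimately show ?thesis by blast
  next
    case False
    then have Beq: "B = {x}" and sx: "s x \<noteq> x"
      using sub[OF B(1)] B(2) by (auto simp: C_def)
    have "Q = add_singletons P"
    proof
      show "add_singletons P \<subseteq> Q"
      proof
        fix E assume "E \<in> add_singletons P"
        then consider "E = {x}" | "E = {s x}" | "E \<in> P" by (auto simp: add_singletons_def)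
        then show "E \<in> Q"
        proof cases
          case 3
          then obtain D where D: "D \<in> Q" "E = D \<inter> A" "E \<noteq> {}"
            by (auto simp: P_def trace_partition_def)
          have "x \<notin> D" "s x \<notin> D"
            using xB[OF D(1)] sxB[OF D(1)] D Beq x_notin sx_notin by auto
          then have "D = E" using D sub[OF D(1)] by auto
          then show ?thesis using D by simp
        qed (use B sB Beq in auto)
      qed
      show "Q \<subseteq> add_singletons P"
      proof
        fix E assume E: "E \<in> Q"
        show "E \<in> add_singletons P"
        proof (cases "x \<in> E \<or> s x \<in> E")
          case True
          then show ?thesis using xB[OF E] sxB[OF E] Beq by (auto simp: add_singletons_def)
        next
          case False
          then have "E \<inter> A = E" using sub[OF E] by auto
          then have "E \<in> P" using E ne[OF E] by (force simp: P_def trace_partition_def)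
          then show ?thesis by (auto simp: add_singletons_def)
        qed
      qed
    qed
    then show ?thesis using sx by blast
  qed
qed

section \<open>Summation over the fibres of the trace map\<close>

lemma fibre_eq:
  assumes P: "P \<in> inv_partitions s A"
  shows "{Q \<in> inv_partitions s A'. trace_partition A Q = P}
    = join_block P ` joinable P \<union> (if s x = x then {} else {add_singletons P})"
  (is "?L = ?R")
proof
  show "?L \<subseteq> ?R" using inv_partition_cases by force
  show "?R \<subseteq> ?L"
    using join_block_in[OF P] trace_join_block[OF P] add_singletons_in[OF P] trace_add_singletons[OF P]
    by auto
qed

text \<open>On \<open>insert C P\<close> the map \<open>enlarge C\<close> is injective and commutes
  with taking images under \<open>s\<close>, so it preserves the type of each block. Counting in
  \<open>insert C P\<close> rather than \<open>P\<close> lets the empty set, which is its own image,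
  stand for a new fixed block.\<close>

lemma fixed_join_block:
  assumes P: "P \<in> inv_partitions s A" and C: "C \<in> joinable P"
  shows "card (fixed_blocks s (join_block P C)) = card (fixed_blocks s (insert C P))"
    and "card (moved_blocks s (join_block P C)) = card (moved_blocks s (insert C P))"
proof -
  have fx: "s ` enlarge C D = enlarge C D \<longleftrightarrow> s ` D = D" if "D \<in> insert C P" for D
    unfolding enlarge_image[symmetric]
    using inj_onD[OF inj_enlarge[OF P C] _ image_in_insert[OF P C that] that] by auto
  have "fixed_blocks s (join_block P C) = enlarge C ` fixed_blocks s (insert C P)"
  proof -
    have "fixed_blocks s (join_block P C)
        = enlarge C ` {D \<in> insert C P. s ` enlarge C D = enlarge C D}"
      unfolding fixed_blocks_def join_block_def by blast
    also have "{D \<in> insert C P. s ` enlarge C D = enlarge C D} = fixed_blocks s (insert C P)"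
      unfolding fixed_blocks_def using fx by (intro Collect_cong conj_cong refl) simp
    finally show ?thesis .
  qed
  then show "card (fixed_blocks s (join_block P C)) = card (fixed_blocks s (insert C P))"
    using inj_on_subset[OF inj_enlarge[OF P C]]
    by (metis (no_types, lifting) card_image fixed_blocks_def mem_Collect_eq subsetI)
  have "moved_blocks s (join_block P C) = enlarge C ` moved_blocks s (insert C P)"
  proof -
    have "moved_blocks s (join_block P C)
        = enlarge C ` {D \<in> insert C P. s ` enlarge C D \<noteq> enlarge C D}"
      unfolding moved_blocks_def join_block_def by blast
    also have "{D \<in> insert C P. s ` enlarge C D \<noteq> enlarge C D} = moved_blocks s (insert C P)"
      unfolding moved_blocks_def using fx by (intro Collect_cong conj_cong refl) simp
    finally show ?thesis .
  qed
  then show "card (moved_blocks s (join_block P C)) = card (moved_blocks s (insert C P))"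
    using inj_on_subset[OF inj_enlarge[OF P C]]
    by (metis (no_types, lifting) card_image moved_blocks_def mem_Collect_eq subsetI)
qed

text \<open>The terms are, in order: a new fixed block, joining a fixed block, two new singletons,
  joining a moved block. The last factor is \<open>q\<close>, not half of it, since joining
  \<open>x\<close> to a moved block or to its image gives different partitions.\<close>

lemma sum_fibre:
  fixes \<phi> :: "nat \<Rightarrow> nat \<Rightarrow> nat"
  assumes P: "P \<in> inv_partitions s A"
  defines "c \<equiv> card (fixed_blocks s P)" and "q \<equiv> card (moved_blocks s P)"
  shows "(\<Sum>Q | Q \<in> inv_partitions s A' \<and> trace_partition A Q = P.
      \<phi> (card (fixed_blocks s Q)) (card (moved_blocks s Q)))
    = \<phi> (Suc c) q + c * \<phi> c q + (if s x = x then 0 else \<phi> c (q + 2) + q * \<phi> c q)"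
proof -
  define \<psi> where "\<psi> Q = \<phi> (card (fixed_blocks s Q)) (card (moved_blocks s Q))" for Q
  have finP: "finite P"
    using P finite_A by (auto simp: inv_partitions_def intro: finite_elements)
  have emp: "{} \<notin> P" using P by (auto simp: inv_partitions_def partition_on_def)
  have J: "joinable P = insert {} (if s x = x then fixed_blocks s P else P)"
    by (simp add: joinable_def)
  have emp_joinable: "{} \<in> joinable P" by (simp add: J)
  have finJ: "finite (joinable P)" using finP by (auto simp: J fixed_blocks_def)
  have "\<psi> (join_block P {}) = \<phi> (Suc c) q"
  proof -
    have "fixed_blocks s (insert {} P) = insert {} (fixed_blocks s P)"
      "moved_blocks s (insert {} P) = moved_blocks s P"
      by (auto simp: fixed_blocks_def moved_blocks_def)
    then show ?thesis
      using fixed_join_block[OF P, of "{}"] emp finP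
      by (simp add: \<psi>_def c_def q_def joinable_def fixed_blocks_def)
  qed
  moreover have "\<psi> (join_block P C) = \<phi> c q" if "C \<in> joinable P - {{}}" for C
  proof -
    have "insert C P = P" using that by (auto simp: joinable_def fixed_blocks_def split: if_splits)
    then show ?thesis using fixed_join_block[OF P, of C] that by (simp add: \<psi>_def c_def q_def)
  qed
  ultimately have "sum \<psi> (join_block P ` joinable P)
      = \<phi> (Suc c) q + card (joinable P - {{}}) * \<phi> c q"
    using sum.remove[OF finJ, of "{}" "\<lambda>C. \<psi> (join_block P C)"]
      sum.reindex[OF inj_join_block[OF P], of \<psi>] emp_joinable
    by simp
  moreover have "card (joinable P - {{}}) = (if s x = x then c else c + q)"
    using emp finP card_fixed_plus_moved[OF finP, of s]
    by (auto simp: J c_def q_def fixed_blocks_def)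
  moreover have "\<psi> (add_singletons P) = \<phi> c (q + 2)" if sx: "s x \<noteq> x"
  proof -
    have nin: "{x} \<notin> P" "{s x} \<notin> P"
      using P x_notin sx_notin by (auto simp: inv_partitions_def partition_on_def)
    have "fixed_blocks s (add_singletons P) = fixed_blocks s P"
      "moved_blocks s (add_singletons P) = insert {x} (insert {s x} (moved_blocks s P))"
      using sx by (auto simp: fixed_blocks_def moved_blocks_def add_singletons_def invol)
    then show ?thesis
      using nin sx finP by (simp add: \<psi>_def c_def q_def moved_blocks_def)
  qed
  moreover have "sum \<psi> (join_block P ` joinable P \<union> {add_singletons P})
      = sum \<psi> (join_block P ` joinable P) + \<psi> (add_singletons P)" if "s x \<noteq> x"
    using finJ add_singletons_ne_join_block[OF P _ that] by (subst sum.union_disjoint) auto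
  ultimately have "sum \<psi> {Q \<in> inv_partitions s A'. trace_partition A Q = P}
    = \<phi> (Suc c) q + c * \<phi> c q + (if s x = x then 0 else \<phi> c (q + 2) + q * \<phi> c q)"
    unfolding fibre_eq[OF P] by (simp add: algebra_simps)
  then show ?thesis by (simp add: \<psi>_def)
qed

text \<open>Inserting an orbit only changes the weight, so an induction over orbits can run with the
  weight kept arbitrary.\<close>

lemma sum_inv_partitions_insert:
  fixes \<phi> :: "nat \<Rightarrow> nat \<Rightarrow> nat"
  shows "(\<Sum>Q \<in> inv_partitions s A'. \<phi> (card (fixed_blocks s Q)) (card (moved_blocks s Q)))
    = (\<Sum>P \<in> inv_partitions s A. (\<lambda>c q. \<phi> (Suc c) q + c * \<phi> c q
        + (if s x = x then 0 else \<phi> c (q + 2) + q * \<phi> c q))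
        (card (fixed_blocks s P)) (card (moved_blocks s P)))"
proof -
  have "finite (inv_partitions s A)" "finite (inv_partitions s A')"
    using finite_A by (auto intro: finite_inv_partitions)
  then have "(\<Sum>Q \<in> inv_partitions s A'. \<phi> (card (fixed_blocks s Q)) (card (moved_blocks s Q)))
     = (\<Sum>P \<in> inv_partitions s A. \<Sum>Q | Q \<in> inv_partitions s A' \<and> trace_partition A Q = P.
      \<phi> (card (fixed_blocks s Q)) (card (moved_blocks s Q)))"
    using trace_in by (intro sum.group[symmetric]) auto
  also have "\<dots> = (\<Sum>P \<in> inv_partitions s A. (\<lambda>c q. \<phi> (Suc c) q + c * \<phi> c q
        + (if s x = x then 0 else \<phi> c (q + 2) + q * \<phi> c q))
        (card (fixed_blocks s P)) (card (moved_blocks s P)))"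
    by (intro sum.cong refl sum_fibre)
  finally show ?thesis .
qed

end


subsection \<open>Counting invariant partitions\<close>

text \<open>Here \<open>p\<close> orbits form \<open>c\<close> fixed blocks and \<open>r\<close>
  free orbits form \<open>m\<close> swapped pairs of blocks, hence \<open>2 * m\<close> moved ones.
  The power of 2 counts how each class of orbits is split into two sides: a class of size
  \<open>t\<close> allows \<open>2 ^ (t - 1)\<close> splittings.\<close>

definition stirling_sum :: "nat \<Rightarrow> nat \<Rightarrow> (nat \<Rightarrow> nat \<Rightarrow> nat) \<Rightarrow> nat" where
  "stirling_sum p r \<phi> =
    (\<Sum>c = 0..p. Stirling p c * (\<Sum>m = 0..r. Stirling r m * 2 ^ (r - m) * \<phi> c (2 * m)))"

text \<open>The Stirling recurrence, transferred from the coefficients to the weight by an index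
  shift.\<close>

lemma sum_Stirling_Suc:
  fixes g :: "nat \<Rightarrow> nat"
  shows "(\<Sum>c = 0..Suc p. Stirling (Suc p) c * g c) = (\<Sum>c = 0..p. Stirling p c * (g (Suc c) + c * g c))"
proof -
  have "(\<Sum>c = 0..p. Suc c * Stirling p (Suc c) * g (Suc c)) = (\<Sum>c = 0..Suc p. c * Stirling p c * g c)"
    unfolding sum.atLeast0_atMost_Suc_shift by simp
  also have "\<dots> = (\<Sum>c = 0..p. c * Stirling p c * g c)" by simp
  finally have *: "(\<Sum>c = 0..p. Suc c * Stirling p (Suc c) * g (Suc c)) = (\<Sum>c = 0..p. c * Stirling p c * g c)" .
  have "(\<Sum>c = 0..Suc p. Stirling (Suc p) c * g c)
      = (\<Sum>c = 0..p. Suc c * Stirling p (Suc c) * g (Suc c)) + (\<Sum>c = 0..p. Stirling p c * g (Suc c))"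
    unfolding sum.atLeast0_atMost_Suc_shift by (simp add: add_mult_distrib sum.distrib del: mult_Suc)
  then show ?thesis
    unfolding * by (simp add: algebra_simps sum.distrib)
qed

text \<open>The power is absorbed into the weight of the preceding recurrence. Since
  \<open>m\<close> is at most \<open>r\<close>, the exponent \<open>Suc r - m\<close> exceeds
  \<open>r - m\<close> by one, which gives the factor 2.\<close>

lemma sum_Stirling_power2_Suc:
  fixes g :: "nat \<Rightarrow> nat"
  shows "(\<Sum>m = 0..Suc r. Stirling (Suc r) m * 2 ^ (Suc r - m) * g m)
    = (\<Sum>m = 0..r. Stirling r m * 2 ^ (r - m) * (g (Suc m) + 2 * m * g m))"
proof -
  have "(\<Sum>m = 0..Suc r. Stirling (Suc r) m * (2 ^ (Suc r - m) * g m))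
    = (\<Sum>m = 0..r. Stirling r m * (2 ^ (r - m) * g (Suc m) + m * (2 ^ (Suc r - m) * g m)))"
    by (simp only: sum_Stirling_Suc diff_Suc_Suc)
  also have "\<dots> = (\<Sum>m = 0..r. Stirling r m * 2 ^ (r - m) * (g (Suc m) + 2 * m * g m))"
    by (intro sum.cong refl) (simp add: Suc_diff_le algebra_simps)
  finally show ?thesis by (simp only: mult.assoc)
qed

lemma stirling_sum_add:
  "stirling_sum p r (\<lambda>c q. \<phi> c q + \<psi> c q) = stirling_sum p r \<phi> + stirling_sum p r \<psi>"
  by (simp add: stirling_sum_def sum.distrib add_mult_distrib2)

lemma stirling_sum_Suc_left:
  "stirling_sum (Suc p) r \<phi> = stirling_sum p r (\<lambda>c q. \<phi> (Suc c) q + c * \<phi> c q)"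
  unfolding stirling_sum_def sum_Stirling_Suc
  by (intro sum.cong refl) (simp add: sum.distrib add_mult_distrib2 sum_distrib_left mult.left_commute)

text \<open>With \<open>q = 2 * m\<close>, a new class of orbits adds two moved blocks, and the
  factor \<open>2 * m\<close> is \<open>q\<close>.\<close>

lemma stirling_sum_Suc_right:
  "stirling_sum p (Suc r) \<phi> = stirling_sum p r (\<lambda>c q. \<phi> c (q + 2) + q * \<phi> c q)"
  unfolding stirling_sum_def sum_Stirling_power2_Suc by simp

lemma inv_partitions_empty: "inv_partitions s {} = {{}}"
  by (auto simp: inv_partitions_def partition_on_empty)

lemma sum_inv_partitions_all_fixed:
  fixes \<phi> :: "nat \<Rightarrow> nat \<Rightarrow> nat"
  assumes "\<And>y. s (s y) = y" and "finite A" and "\<And>y. y \<in> A \<Longrightarrow> s y = y"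
  shows "(\<Sum>P \<in> inv_partitions s A. \<phi> (card (fixed_blocks s P)) (card (moved_blocks s P)))
    = stirling_sum (card A) 0 \<phi>"
  using assms(2,3)
proof (induction A arbitrary: \<phi> rule: finite_induct)
  case empty
  show ?case
    by (simp add: inv_partitions_empty fixed_blocks_def moved_blocks_def stirling_sum_def)
next
  case (insert x A)
  interpret orbit_insertion s A x
    by unfold_locales (use assms(1) insert in auto)
  have sx: "s x = x" using insert.prems by auto
  then have insert_eq: "insert x A = A'" by auto
  let ?\<psi> = "\<lambda>c q. \<phi> (Suc c) q + c * \<phi> c q + (if s x = x then 0 else \<phi> c (q + 2) + q * \<phi> c q)"
  have "(\<Sum>P \<in> inv_partitions s A'. \<phi> (card (fixed_blocks s P)) (card (moved_blocks s P)))
    = stirling_sum (card A) 0 ?\<psi>"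
    unfolding sum_inv_partitions_insert by (rule insert.IH[of ?\<psi>]) (use insert.prems in auto)
  then show ?case
    unfolding insert_eq[symmetric] using insert.hyps sx by (simp add: stirling_sum_Suc_left)
qed

text \<open>The index \<open>k\<close> is the number of free orbits that go into fixed blocks.
  Removing one free orbit reduces the claim to \<open>N\<close>, and Pascal's rule recombines its
  two kinds of options.\<close>

lemma sum_inv_partitions:
  fixes \<phi> :: "nat \<Rightarrow> nat \<Rightarrow> nat"
  assumes "\<And>y. s (s y) = y" and "finite A" and "\<And>y. y \<in> A \<Longrightarrow> s y \<in> A"
    and "card {y \<in> A. s y = y} = n" and "card {y \<in> A. s y \<noteq> y} = 2 * N"
  shows "(\<Sum>P \<in> inv_partitions s A. \<phi> (card (fixed_blocks s P)) (card (moved_blocks s P)))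
    = (\<Sum>k = 0..N. (N choose k) * stirling_sum (n + k) (N - k) \<phi>)"
  using assms(2-)
proof (induction N arbitrary: A \<phi>)
  case 0
  then have "{y \<in> A. s y \<noteq> y} = {}" by simp
  then have "\<And>y. y \<in> A \<Longrightarrow> s y = y" by blast
  moreover from this have "{y \<in> A. s y = y} = A" by blast
  ultimately show ?case
    using sum_inv_partitions_all_fixed[OF assms(1) 0(1), of \<phi>] 0 by simp
next
  case (Suc N)
  let ?M = "{y \<in> A. s y \<noteq> y}"
  obtain x where x: "x \<in> A" "s x \<noteq> x"
  proof -
    have "card ?M \<noteq> 0" using Suc.prems(4) by simp
    then have "?M \<noteq> {}" by (rule contrapos_nn) (simp only: card.empty)
    then show ?thesis using that by blast
  qed
  define B where "B = A - {x, s x}"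
  have inj: "s y = s z \<longleftrightarrow> y = z" for y z by (metis assms(1))
  have Bcl: "s y \<in> B" if "y \<in> B" for y
    using that Suc.prems(2) inj[of y x] inj[of y "s x"] by (auto simp: B_def assms(1))
  interpret orbit_insertion s B x
    by unfold_locales (use assms(1) Suc.prems Bcl in \<open>auto simp: B_def\<close>)
  have A_eq: "A = B \<union> {x, s x}" using x Suc.prems(2) by (auto simp: B_def)
  have "{y \<in> B. s y = y} = {y \<in> A. s y = y}"
    using x by (auto simp: B_def assms(1))
  then have fx: "card {y \<in> B. s y = y} = n" using Suc.prems by simp
  have "{y \<in> B. s y \<noteq> y} = ?M - {x, s x}" by (auto simp: B_def)
  moreover have "{x, s x} \<subseteq> ?M" using x Suc.prems(2) inj[of "s x" x] by auto
  ultimately have mv: "card {y \<in> B. s y \<noteq> y} = 2 * N"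
    using Suc.prems x(2) by (simp add: card_Diff_subset)
  have finB: "finite B" using Suc.prems by (simp add: B_def)
  let ?\<psi> = "\<lambda>c q. \<phi> (Suc c) q + c * \<phi> c q + (if s x = x then 0 else \<phi> c (q + 2) + q * \<phi> c q)"
  \<comment> \<open>The first two options for the removed orbit turn the summand at \<open>k\<close>
    into \<open>T (Suc k)\<close>, the last two into \<open>T k\<close>.\<close>
  define T where "T k = stirling_sum (n + k) (Suc N - k) \<phi>" for k
  have "(\<Sum>P \<in> inv_partitions s A. \<phi> (card (fixed_blocks s P)) (card (moved_blocks s P)))
    = (\<Sum>k = 0..N. (N choose k) * stirling_sum (n + k) (N - k) ?\<psi>)"
    unfolding A_eq sum_inv_partitions_insert by (rule Suc.IH[OF finB Bcl fx mv, of ?\<psi>])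
  also have "\<dots> = (\<Sum>k = 0..N. (N choose k) * (T (Suc k) + T k))"
    using x(2)
    by (intro sum.cong refl)
      (simp add: T_def stirling_sum_add stirling_sum_Suc_left stirling_sum_Suc_right Suc_diff_le)
  \<comment> \<open>The second sum may run to \<open>Suc N\<close> because
    \<open>N choose Suc N\<close> is 0; this prepares Pascal's rule.\<close>
  also have "\<dots> = (\<Sum>k = 0..N. (N choose k) * T (Suc k)) + (\<Sum>k = 0..Suc N. (N choose k) * T k)"
    by (simp add: add_mult_distrib2 sum.distrib)
  also have "\<dots> = (\<Sum>k = 0..Suc N. (Suc N choose k) * T k)"
    unfolding sum.atLeast0_atMost_Suc_shift by (simp add: add_mult_distrib sum.distrib)
  finally show ?case by (simp add: T_def)
qed

subsection \<open>Right ideals and fibre partitions\<close>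

definition swap_pair :: "('a \<times> 'a \<Rightarrow> 'a) \<Rightarrow> 'a \<times> 'a \<Rightarrow> 'a \<times> 'a" where
  "swap_pair f p = (f p, f (prod.swap p))"

definition fibre_partition :: "'a set \<Rightarrow> ('a \<times> 'a \<Rightarrow> 'a) \<Rightarrow> ('a \<times> 'a) set set" where
  "fibre_partition X f =
    (\<lambda>p. {q \<in> X \<times> X. swap_pair f q = swap_pair f p}) ` (X \<times> X)"

lemma swap_pair_swap: "swap_pair f (prod.swap p) = prod.swap (swap_pair f p)"
  by (simp add: swap_pair_def)

lemma swap_in_Times_iff [simp]: "prod.swap p \<in> X \<times> X \<longleftrightarrow> p \<in> X \<times> X"
  by (cases p) auto

lemma swap_pair_in:
  "f \<in> X \<times> X \<rightarrow>\<^sub>E X \<Longrightarrow> p \<in> X \<times> X \<Longrightarrow> swap_pair f p \<in> X \<times> X"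
  by (cases p) (auto simp: swap_pair_def PiE_iff)

lemma principal_right_ideal_eq:
  "principal_right_ideal (binop_monoid X) f =
    (\<lambda>g. \<lambda>p\<in>X \<times> X. g (swap_pair f p)) ` (X \<times> X \<rightarrow>\<^sub>E X)"
proof -
  have "(\<lambda>(a, b)\<in>X \<times> X. g (f (a, b), f (b, a))) = (\<lambda>p\<in>X \<times> X. g (swap_pair f p))" for g :: "'a \<times> 'a \<Rightarrow> 'a"
    by (auto simp: fun_eq_iff restrict_def swap_pair_def)
  then show ?thesis
    by (auto simp: principal_right_ideal_def binop_monoid_def)
qed

lemma same_block_iff:
  assumes "p \<in> X \<times> X" "q \<in> X \<times> X"
  shows "(\<exists>B \<in> fibre_partition X f. p \<in> B \<and> q \<in> B) \<longleftrightarrow> swap_pair f p = swap_pair f q"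
proof
  assume "\<exists>B \<in> fibre_partition X f. p \<in> B \<and> q \<in> B"
  then show "swap_pair f p = swap_pair f q"
    unfolding fibre_partition_def by auto
next
  let ?B = "{r \<in> X \<times> X. swap_pair f r = swap_pair f p}"
  assume "swap_pair f p = swap_pair f q"
  then have "p \<in> ?B" "q \<in> ?B" using assms by simp_all
  moreover have "?B \<in> fibre_partition X f"
    unfolding fibre_partition_def using assms(1) by (rule imageI)
  ultimately show "\<exists>B \<in> fibre_partition X f. p \<in> B \<and> q \<in> B"
    by (intro bexI[of _ ?B] conjI)
qed

lemma fibre_partition_eq_iff:
  "fibre_partition X f = fibre_partition X h \<longleftrightarrow>
    (\<forall>p \<in> X \<times> X. \<forall>q \<in> X \<times> X. swap_pair f p = swap_pair f q \<longleftrightarrow> swap_pair h p = swap_pair h q)"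
proof
  assume "fibre_partition X f = fibre_partition X h"
  then show "\<forall>p \<in> X \<times> X. \<forall>q \<in> X \<times> X. swap_pair f p = swap_pair f q \<longleftrightarrow> swap_pair h p = swap_pair h q"
    using same_block_iff[of _ X _ f] same_block_iff[of _ X _ h] by simp
next
  assume "\<forall>p \<in> X \<times> X. \<forall>q \<in> X \<times> X. swap_pair f p = swap_pair f q \<longleftrightarrow> swap_pair h p = swap_pair h q"
  then show "fibre_partition X f = fibre_partition X h"
    unfolding fibre_partition_def by (intro image_cong refl Collect_cong) blast
qed

text \<open>By the kernel condition \<open>swap_pair f\<close> factors through
  \<open>swap_pair h\<close>, hence so does everything that factors through
  \<open>swap_pair f\<close>.\<close>

lemma principal_right_ideal_subset:
  assumes "f \<in> X \<times> X \<rightarrow>\<^sub>E X" "h \<in> X \<times> X \<rightarrow>\<^sub>E X"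
    and ker: "\<And>p q. p \<in> X \<times> X \<Longrightarrow> q \<in> X \<times> X \<Longrightarrow>
      swap_pair h p = swap_pair h q \<Longrightarrow> swap_pair f p = swap_pair f q"
  shows "principal_right_ideal (binop_monoid X) f \<subseteq> principal_right_ideal (binop_monoid X) h"
proof
  fix u assume "u \<in> principal_right_ideal (binop_monoid X) f"
  then obtain g where g: "g \<in> X \<times> X \<rightarrow>\<^sub>E X" and u: "u = (\<lambda>p\<in>X \<times> X. g (swap_pair f p))"
    unfolding principal_right_ideal_eq by blast
  \<comment> \<open>Off the range of \<open>swap_pair h\<close> any element of \<open>X\<close> will
    do, and \<open>f y\<close> is one.\<close>
  define k where "k = (\<lambda>y\<in>X \<times> X. if y \<in> swap_pair h ` (X \<times> X)
    then g (swap_pair f (inv_into (X \<times> X) (swap_pair h) y)) else f y)"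
  have "k \<in> X \<times> X \<rightarrow>\<^sub>E X"
  proof (rule PiE_I)
    fix y assume y: "y \<in> X \<times> X"
    show "k y \<in> X"
    proof (cases "y \<in> swap_pair h ` (X \<times> X)")
      case True
      then have "swap_pair f (inv_into (X \<times> X) (swap_pair h) y) \<in> X \<times> X"
        using swap_pair_in[OF assms(1)] inv_into_into by metis
      then have "g (swap_pair f (inv_into (X \<times> X) (swap_pair h) y)) \<in> X"
        using g by (rule PiE_mem[rotated])
      then show ?thesis using True y unfolding k_def by simp
    next
      case False
      then show ?thesis using y PiE_mem[OF assms(1) y] unfolding k_def by simp
    qed
  qed (simp add: k_def)
  moreover have "k (swap_pair h p) = g (swap_pair f p)" if p: "p \<in> X \<times> X" for p
  proof -
    let ?i = "inv_into (X \<times> X) (swap_pair h) (swap_pair h p)"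
    have i: "?i \<in> X \<times> X" "swap_pair h ?i = swap_pair h p"
      using p by (auto intro: inv_into_into f_inv_into_f)
    have "swap_pair f ?i = swap_pair f p" by (rule ker[OF i(1) p i(2)])
    then show ?thesis using p swap_pair_in[OF assms(2) p] by (simp add: k_def)
  qed
  then have "u = (\<lambda>p\<in>X \<times> X. k (swap_pair h p))"
    unfolding u by (intro restrict_ext) simp
  ultimately show "u \<in> principal_right_ideal (binop_monoid X) h"
    unfolding principal_right_ideal_eq by blast
qed

text \<open>An operation lies in its own right ideal, so \<open>f\<close> factors through
  \<open>swap_pair h\<close>.\<close>

lemma principal_right_ideal_subset_kernel:
  assumes f: "f \<in> X \<times> X \<rightarrow>\<^sub>E X"
    and sub: "principal_right_ideal (binop_monoid X) f \<subseteq> principal_right_ideal (binop_monoid X) h"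
    and pq: "p \<in> X \<times> X" "q \<in> X \<times> X" and eq: "swap_pair h p = swap_pair h q"
  shows "swap_pair f p = swap_pair f q"
proof -
  \<comment> \<open>The restricted first projection is the identity of the monoid.\<close>
  have "f = (\<lambda>p\<in>X \<times> X. (\<lambda>p\<in>X \<times> X. fst p) (swap_pair f p))"
  proof
    fix p show "f p = (\<lambda>p\<in>X \<times> X. (\<lambda>p\<in>X \<times> X. fst p) (swap_pair f p)) p"
    proof (cases "p \<in> X \<times> X")
      case True
      show ?thesis
        unfolding restrict_apply'[OF True] restrict_apply'[OF swap_pair_in[OF f True]]
        by (simp add: swap_pair_def)
    next
      case False
      then show ?thesis using PiE_arb[OF f False] by (simp only: restrict_apply if_False)
    qed
  qed
  moreover have "(\<lambda>p\<in>X \<times> X. fst p) \<in> X \<times> X \<rightarrow>\<^sub>E X" by auto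
  ultimately have "f \<in> principal_right_ideal (binop_monoid X) f"
    unfolding principal_right_ideal_eq by blast
  then obtain g where g: "f = (\<lambda>p\<in>X \<times> X. g (swap_pair h p))"
    using sub unfolding principal_right_ideal_eq by blast
  have val: "f r = g (swap_pair h r)" if "r \<in> X \<times> X" for r
    using that fun_cong[OF g, of r] by simp
  \<comment> \<open>Equality at the swapped points settles the second coordinate of
    \<open>swap_pair f\<close>.\<close>
  have "swap_pair h (prod.swap p) = swap_pair h (prod.swap q)"
    by (simp add: swap_pair_swap eq)
  then show ?thesis
    unfolding swap_pair_def[of f] using val pq eq by simp
qed

lemma principal_right_ideal_eq_iff:
  assumes "f \<in> X \<times> X \<rightarrow>\<^sub>E X" "h \<in> X \<times> X \<rightarrow>\<^sub>E X"
  shows "principal_right_ideal (binop_monoid X) f = principal_right_ideal (binop_monoid X) h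
    \<longleftrightarrow> fibre_partition X f = fibre_partition X h"
proof
  assume "principal_right_ideal (binop_monoid X) f = principal_right_ideal (binop_monoid X) h"
  then show "fibre_partition X f = fibre_partition X h"
    unfolding fibre_partition_eq_iff
    using principal_right_ideal_subset_kernel assms by (metis order_refl)
next
  assume "fibre_partition X f = fibre_partition X h"
  then show "principal_right_ideal (binop_monoid X) f = principal_right_ideal (binop_monoid X) h"
    unfolding fibre_partition_eq_iff
    using principal_right_ideal_subset[OF assms] principal_right_ideal_subset[OF assms(2,1)]
    by (intro equalityI) blast+
qed

section \<open>Characterisation of the fibre partitions\<close>

lemma fibre_partition_inv:
  "fibre_partition X f \<in> inv_partitions prod.swap (X \<times> X)"
proof -
  have "partition_on (X \<times> X) (fibre_partition X f)"
    by (rule partition_onI) (auto simp: fibre_partition_def disjnt_def)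
  moreover have "prod.swap ` B \<in> fibre_partition X f" if "B \<in> fibre_partition X f" for B
  proof -
    obtain p where p: "p \<in> X \<times> X" and B: "B = {q \<in> X \<times> X. swap_pair f q = swap_pair f p}"
      using \<open>B \<in> fibre_partition X f\<close> unfolding fibre_partition_def by blast
    have sB: "prod.swap ` B = {q \<in> X \<times> X. swap_pair f q = swap_pair f (prod.swap p)}"
    proof (intro equalityI subsetI)
      fix q assume "q \<in> {q \<in> X \<times> X. swap_pair f q = swap_pair f (prod.swap p)}"
      then have "q \<in> X \<times> X" "swap_pair f q = prod.swap (swap_pair f p)"
        by (simp_all add: swap_pair_swap)
      then have "prod.swap q \<in> B" unfolding B by (simp add: swap_pair_swap)
      then show "q \<in> prod.swap ` B" by (metis image_eqI swap_swap)
    next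
      fix q assume "q \<in> prod.swap ` B"
      then obtain r where r: "r \<in> B" "q = prod.swap r" by (rule imageE)
      then show "q \<in> {q \<in> X \<times> X. swap_pair f q = swap_pair f (prod.swap p)}"
        unfolding B r(2) by (simp only: mem_Collect_eq swap_in_Times_iff swap_pair_swap)
    qed
    show ?thesis
      unfolding fibre_partition_def sB by (rule imageI) (simp only: swap_in_Times_iff p)
  qed
  ultimately show ?thesis by (simp add: inv_partitions_def)
qed

text \<open>A fixed fibre contains \<open>prod.swap p\<close> along with \<open>p\<close>, so its
  value is invariant under the swap and lies on the diagonal. Distinct fibres have distinct
  values.\<close>

lemma card_fixed_blocks_fibre_partition:
  assumes f: "f \<in> X \<times> X \<rightarrow>\<^sub>E X" and "finite X"
  shows "card (fixed_blocks prod.swap (fibre_partition X f)) \<le> card X"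
proof (rule surj_card_le[OF \<open>finite X\<close>])
  show "fixed_blocks prod.swap (fibre_partition X f)
      \<subseteq> (\<lambda>x. {q \<in> X \<times> X. swap_pair f q = (x, x)}) ` X"
  proof
    fix B assume "B \<in> fixed_blocks prod.swap (fibre_partition X f)"
    then obtain p where p: "p \<in> X \<times> X" and B: "B = {q \<in> X \<times> X. swap_pair f q = swap_pair f p}"
      and fx: "prod.swap ` B = B"
      unfolding fibre_partition_def fixed_blocks_def by blast
    have "prod.swap p \<in> B" using p fx B by blast
    then have "swap_pair f p = prod.swap (swap_pair f p)" by (simp add: B swap_pair_swap)
    then have "f (prod.swap p) = f p"
      unfolding swap_pair_def by (metis fst_conv fst_swap snd_conv)
    then have "swap_pair f p = (f p, f p)" by (simp add: swap_pair_def)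
    moreover have "f p \<in> X" using f p by (rule PiE_mem)
    ultimately show "B \<in> (\<lambda>x. {q \<in> X \<times> X. swap_pair f q = (x, x)}) ` X"
      unfolding B by simp
  qed
qed

text \<open>Fixed blocks are sent injectively to the diagonal; a moved block \<open>B\<close> is sent to the member
  it contains of an orbit chosen inside \<open>B \<union> prod.swap ` B\<close>.\<close>

lemma ex_fibre_partition:
  assumes P: "P \<in> inv_partitions prod.swap (X \<times> X)" and fin: "finite X"
    and le: "card (fixed_blocks prod.swap P) \<le> card X"
  shows "\<exists>f \<in> X \<times> X \<rightarrow>\<^sub>E X. fibre_partition X f = P"
proof -
  have part: "partition_on (X \<times> X) P" and inv: "\<And>B. B \<in> P \<Longrightarrow> prod.swap ` B \<in> P"
    using P by (auto simp: inv_partitions_def)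
  have sub: "B \<subseteq> X \<times> X" and ne: "B \<noteq> {}" if "B \<in> P" for B
    using part that by (auto simp: partition_on_def)
  have uniq: "B = C" if "B \<in> P" "C \<in> P" "y \<in> B" "y \<in> C" for B C y
    using partition_on_block_unique[OF part] that by blast
  have ss: "prod.swap ` prod.swap ` B = B" for B :: "('a \<times> 'a) set"
    by (simp add: image_image)
  have "finite P" using part fin by (intro finite_elements[OF _ part] finite_cartesian_product)
  then have "finite (fixed_blocks prod.swap P)" by (simp add: fixed_blocks_def)
  then obtain d where d: "inj_on d (fixed_blocks prod.swap P)" "d ` fixed_blocks prod.swap P \<subseteq> X"
    using card_le_inj[OF _ fin le] by blast
  \<comment> \<open>The choice depends only on the union, so a block and its image select the same
    point. This makes \<open>G\<close> commute with the swap.\<close>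
  define r where "r B = (SOME p. p \<in> B \<union> prod.swap ` B)" for B :: "('a \<times> 'a) set"
  define G where "G B = (if prod.swap ` B = B then (d B, d B)
    else if r B \<in> B then r B else prod.swap (r B))" for B
  have G_fixed: "G B = (d B, d B)" if "prod.swap ` B = B" for B
    using that by (simp add: G_def)
  have r_in: "r B \<in> B \<union> prod.swap ` B" if "B \<in> P" for B
    unfolding r_def by (rule someI_ex) (use ne[OF that] in blast)
  have r_swap: "r (prod.swap ` B) = r B" for B
    by (simp only: r_def ss Un_commute)
  have G_moved: "G B \<in> B" if "B \<in> P" "prod.swap ` B \<noteq> B" for B
    using r_in[OF that(1)] that(2) by (auto simp: G_def)
  have disj: "B \<inter> prod.swap ` B = {}" if "B \<in> P" "prod.swap ` B \<noteq> B" for B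
    using uniq[OF that(1) inv[OF that(1)]] that(2) by blast
  have G_in: "G B \<in> X \<times> X" if "B \<in> P" for B
  proof (cases "prod.swap ` B = B")
    case True
    then have "d B \<in> X" using d(2) that by (auto simp: fixed_blocks_def)
    then show ?thesis using True by (simp add: G_def)
  next
    case False
    then show ?thesis using G_moved sub that by blast
  qed
  have G_swap: "G (prod.swap ` B) = prod.swap (G B)" if B: "B \<in> P" for B
  proof (cases "prod.swap ` B = B")
    case True
    then show ?thesis by (simp add: G_def)
  next
    case False
    have "r B \<in> prod.swap ` B \<longleftrightarrow> r B \<notin> B"
      using r_in[OF B] disj[OF B False] by blast
    then show ?thesis using False by (auto simp: G_def r_swap ss)
  qed
  \<comment> \<open>A moved block is disjoint from its image and so contains no diagonal point.
    Hence values of moved blocks never collide with those of fixed blocks.\<close>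
  have G_diag: "fst (G B) \<noteq> snd (G B)" if "B \<in> P" "prod.swap ` B \<noteq> B" for B
  proof
    assume "fst (G B) = snd (G B)"
    then have "prod.swap (G B) = G B" by (simp add: prod_eq_iff)
    then have "G B \<in> prod.swap ` B" using G_moved[OF that] by (metis imageI)
    then show False using G_moved[OF that] disj[OF that] by blast
  qed
  have G_inj: "B = C" if B: "B \<in> P" and C: "C \<in> P" and eq: "G B = G C" for B C
  proof (cases "prod.swap ` B = B")
    case True
    then have "prod.swap ` C = C"
      using G_diag[OF C] eq G_fixed[OF True] by (metis fst_conv snd_conv)
    then have "d B = d C" "B \<in> fixed_blocks prod.swap P" "C \<in> fixed_blocks prod.swap P"
      using eq G_fixed[of B] G_fixed[of C] True B C by (simp_all add: fixed_blocks_def)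
    then show ?thesis using d(1) by (blast dest: inj_onD)
  next
    case False
    then have "prod.swap ` C \<noteq> C"
      using G_diag[OF B] eq G_fixed[of C] by (metis fst_conv snd_conv)
    then show ?thesis using G_moved[OF B False] G_moved[OF C] eq uniq[OF B C] by simp
  qed
  define bl where "bl p = (THE B. B \<in> P \<and> p \<in> B)" for p
  have bl: "bl p = B" if "B \<in> P" "p \<in> B" for B p
    unfolding bl_def by (rule the_equality) (use that uniq in blast)+
  have bl_ex: "bl p \<in> P" "p \<in> bl p" if p: "p \<in> X \<times> X" for p
  proof -
    obtain B where B: "B \<in> P" "p \<in> B"
      using part p unfolding partition_on_def by blast
    then show "bl p \<in> P" "p \<in> bl p" using bl[OF B] by simp_all
  qed
  \<comment> \<open>Only the first coordinate is prescribed; the second is then correct because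
    \<open>G\<close> commutes with the swap.\<close>
  define f where "f = (\<lambda>p\<in>X \<times> X. fst (G (bl p)))"
  have F: "swap_pair f p = G (bl p)" if p: "p \<in> X \<times> X" for p
  proof -
    have "bl (prod.swap p) = prod.swap ` bl p"
      by (rule bl) (use inv bl_ex[OF p] in blast)+
    then have "G (bl (prod.swap p)) = prod.swap (G (bl p))"
      using G_swap bl_ex(1)[OF p] by simp
    then show ?thesis
      using p by (simp only: swap_pair_def f_def restrict_apply swap_in_Times_iff if_True
        fst_swap prod.collapse)
  qed
  have f_in: "f \<in> X \<times> X \<rightarrow>\<^sub>E X"
  proof (rule PiE_I)
    fix p assume p: "p \<in> X \<times> X"
    then have "fst (G (bl p)) \<in> X" using G_in[OF bl_ex(1)[OF p]] by (simp add: mem_Times_iff)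
    then show "f p \<in> X" using p by (simp only: f_def restrict_apply if_True)
  qed (simp only: f_def restrict_apply if_False)
  have block: "{q \<in> X \<times> X. swap_pair f q = swap_pair f p} = bl p" if p: "p \<in> X \<times> X" for p
  proof (intro equalityI subsetI)
    fix q assume "q \<in> {q \<in> X \<times> X. swap_pair f q = swap_pair f p}"
    then have q: "q \<in> X \<times> X" and "swap_pair f q = swap_pair f p" by simp_all
    then have "G (bl q) = G (bl p)" by (simp only: F p)
    with q have "bl q = bl p" using G_inj bl_ex(1) p by blast
    then show "q \<in> bl p" using bl_ex(2)[OF q] by simp
  next
    fix q assume q: "q \<in> bl p"
    then have "q \<in> X \<times> X" using sub bl_ex(1)[OF p] by blast
    moreover have "bl q = bl p" using bl[OF bl_ex(1)[OF p] q] .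
    ultimately show "q \<in> {q \<in> X \<times> X. swap_pair f q = swap_pair f p}" using F p by simp
  qed
  have "fibre_partition X f = bl ` (X \<times> X)"
    unfolding fibre_partition_def by (intro image_cong refl block)
  also have "\<dots> = P"
  proof
    show "bl ` (X \<times> X) \<subseteq> P" using bl_ex(1) by blast
    show "P \<subseteq> bl ` (X \<times> X)"
    proof
      fix B assume B: "B \<in> P"
      then obtain p where "p \<in> B" using ne by blast
      then show "B \<in> bl ` (X \<times> X)" using bl[OF B] sub[OF B] by blast
    qed
  qed
  finally show ?thesis using f_in by blast
qed

section \<open>The final count\<close>

lemma card_image_eq_if_same_kernel:
  assumes "\<And>x y. x \<in> A \<Longrightarrow> y \<in> A \<Longrightarrow> f x = f y \<longleftrightarrow> g x = g y"
  shows "card (f ` A) = card (g ` A)"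
proof -
  have "bij_betw (\<lambda>u. g (inv_into A f u)) (f ` A) (g ` A)"
  proof (rule bij_betwI')
    fix u v assume "u \<in> f ` A" "v \<in> f ` A"
    then show "g (inv_into A f u) = g (inv_into A f v) \<longleftrightarrow> u = v"
      using assms by (metis f_inv_into_f inv_into_into)
  next
    fix u assume "u \<in> f ` A"
    then show "g (inv_into A f u) \<in> g ` A" by (blast intro: inv_into_into)
  next
    fix v assume "v \<in> g ` A"
    then obtain x where x: "x \<in> A" "v = g x" by blast
    then have "g (inv_into A f (f x)) = g x"
      using assms by (metis f_inv_into_f inv_into_into imageI)
    then show "\<exists>u \<in> f ` A. v = g (inv_into A f u)" using x(1) unfolding x(2) by force
  qed
  then show ?thesis by (rule bij_betw_same_card)
qed

lemma card_off_diagonal: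
  assumes "finite X"
  shows "card {p \<in> X \<times> X. prod.swap p = p} = card X"
    and "card {p \<in> X \<times> X. prod.swap p \<noteq> p} = 2 * (card X choose 2)"
proof -
  have "{p \<in> X \<times> X. prod.swap p = p} = (\<lambda>x. (x, x)) ` X"
    by (force simp: prod_eq_iff mem_Times_iff)
  then show diag: "card {p \<in> X \<times> X. prod.swap p = p} = card X"
    by (simp add: card_image inj_on_def)
  have "{p \<in> X \<times> X. prod.swap p \<noteq> p} = X \<times> X - {p \<in> X \<times> X. prod.swap p = p}" by blast
  then have "card {p \<in> X \<times> X. prod.swap p \<noteq> p} = card X * card X - card X"
    using diag assms by (simp add: card_Diff_subset card_cartesian_product)
  also have "\<dots> = card X * (card X - 1)" by (simp add: diff_mult_distrib2)
  also have "\<dots> = 2 * (card X choose 2)"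
    using dvd_mult_div_cancel[of 2 "card X * (card X - 1)"] by (cases "card X") (auto simp: choose_two)
  finally show "card {p \<in> X \<times> X. prod.swap p \<noteq> p} = 2 * (card X choose 2)" .
qed

theorem theorem14:
  fixes X :: "'a set" and n N :: nat
  assumes "finite X" and "X \<noteq> {}" and "card X = n" and "N = n choose 2"
  shows "card {principal_right_ideal (binop_monoid X) f | f. f \<in> carrier (binop_monoid X)} =
    (\<Sum>c = 1..n. \<Sum>k = 0..N. (N choose k) * Stirling (n + k) c *
      (\<Sum>m = 0..N - k. Stirling (N - k) m * 2 ^ (N - k - m)))"
proof -
  let ?I = "inv_partitions prod.swap (X \<times> X)"
  \<comment> \<open>The indicator weight turns the bound on the number of fixed blocks into a
    weighted sum over all invariant partitions.\<close>
  let ?few = "\<lambda>c (q::nat). if c \<le> n then 1 else 0 :: nat"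
  have n: "n > 0" using assms by auto
  have finI: "finite ?I" using assms(1) by (simp add: finite_inv_partitions)
  have "{principal_right_ideal (binop_monoid X) f | f. f \<in> carrier (binop_monoid X)}
      = principal_right_ideal (binop_monoid X) ` (X \<times> X \<rightarrow>\<^sub>E X)"
    by (auto simp: binop_monoid_def)
  then have "card {principal_right_ideal (binop_monoid X) f | f. f \<in> carrier (binop_monoid X)}
      = card (fibre_partition X ` (X \<times> X \<rightarrow>\<^sub>E X))"
    by (simp only:) (intro card_image_eq_if_same_kernel principal_right_ideal_eq_iff)
  also have "fibre_partition X ` (X \<times> X \<rightarrow>\<^sub>E X) = {P \<in> ?I. card (fixed_blocks prod.swap P) \<le> n}"
  proof (intro equalityI subsetI)
    fix P assume "P \<in> {P \<in> ?I. card (fixed_blocks prod.swap P) \<le> n}"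
    then show "P \<in> fibre_partition X ` (X \<times> X \<rightarrow>\<^sub>E X)"
      using ex_fibre_partition[of P X] assms(1,3) by blast
  next
    fix P assume "P \<in> fibre_partition X ` (X \<times> X \<rightarrow>\<^sub>E X)"
    then obtain f where f: "f \<in> X \<times> X \<rightarrow>\<^sub>E X" "P = fibre_partition X f" by blast
    then show "P \<in> {P \<in> ?I. card (fixed_blocks prod.swap P) \<le> n}"
      using fibre_partition_inv card_fixed_blocks_fibre_partition[OF f(1) assms(1)] assms(3) by blast
  qed
  also have "card \<dots> = (\<Sum>P \<in> ?I. ?few (card (fixed_blocks prod.swap P)) (card (moved_blocks prod.swap P)))"
    using finI by (simp add: sum.If_cases Int_def)
  also have "\<dots> = (\<Sum>k = 0..N. (N choose k) * stirling_sum (n + k) (N - k) ?few)"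
    by (rule sum_inv_partitions) (use assms card_off_diagonal in auto)
  also have "\<dots> = (\<Sum>k = 0..N. \<Sum>c = 1..n. (N choose k) * Stirling (n + k) c *
      (\<Sum>m = 0..N - k. Stirling (N - k) m * 2 ^ (N - k - m)))"
  proof (intro sum.cong refl)
    fix k
    \<comment> \<open>The term \<open>m = 0\<close> is nonzero only for \<open>k = N\<close>, when
      no orbit is left for moved blocks.\<close>
    let ?t = "\<Sum>m = 0..N - k. Stirling (N - k) m * 2 ^ (N - k - m)"
    have "stirling_sum (n + k) (N - k) ?few
        = (\<Sum>c = 0..n + k. if c \<le> n then Stirling (n + k) c * ?t else 0)"
      unfolding stirling_sum_def by (intro sum.cong refl) simp
    \<comment> \<open>The indicator removes \<open>c > n\<close>, and \<open>c = 0\<close>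
      contributes nothing because \<open>n + k\<close> is positive.\<close>
    also have "\<dots> = (\<Sum>c = 1..n. Stirling (n + k) c * ?t)"
    proof (rule sum.mono_neutral_cong_right)
      show "\<forall>c \<in> {0..n + k} - {1..n}. (if c \<le> n then Stirling (n + k) c * ?t else 0) = 0"
      proof
        fix c assume "c \<in> {0..n + k} - {1..n}"
        then have "c = 0 \<or> c > n" by auto
        moreover have "Stirling (n + k) 0 = 0" using n by (cases "n + k") auto
        ultimately show "(if c \<le> n then Stirling (n + k) c * ?t else 0) = 0" by auto
      qed
    qed auto
    finally show "(N choose k) * stirling_sum (n + k) (N - k) ?few
        = (\<Sum>c = 1..n. (N choose k) * Stirling (n + k) c * ?t)"
      by (simp add: sum_distrib_left mult.assoc)
  qed
  finally show ?thesis by (subst sum.swap)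
qed

end
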